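(* Let $C$ be a $d$-variate Archimedean copula with generator $\phi$ and let $(U_1,\ldots,U_d)$ have distribution function $C$. If the limit $$\theta_0 := -\lim_{s\downarrow 0}\frac{s\,\phi'(s)}{\phi(s)}$$ exists in $[0,\infty]$, then for every $I\subset\{1,\ldots,d\}$ with $|I|\geq 2$ and every $(x_i)_{i\in I}\in(0,\infty)^{|I|}$, $$\lim_{s\downarrow 0}s^{-1}\Pr[\forall i\in I: U_i\leq s x_i]=\begin{cases}0 & \text{if }\theta_0=0,\\ \bigl(\sum_{i\in I}x_i^{-\theta_0}\bigr)^{-1/\theta_0} & \text{if }0<\theta_0<\infty,\\ \bigwedge_{i\in I}x_i & \text{if }\theta_0=\infty.\end{cases}$$
   Context: Fix an integer $d\geq 2$. An Archimedean generator is a convex, decreasing function $\phi:[0,1]\to[0,\infty]$ with $\phi(1)=0$; its generalized inverse is $\phi^{\leftarrow}(y)=\inf\{t\in[0,1]:\phi(t)\leq y\}$ for $y\in[0,\infty]$. The Archimedean copula with generator $\phi$ is $C(u_1,\ldots,u_d)=\phi^{\leftarrow}(\phi(u_1)+\cdots+\phi(u_d))$ on $[0,1]^d$; it is assumed throughout that $C$ is indeed a copula, i.e. (the restriction to $[0,1]^d$ of) a distribution function with uniform$(0,1)$ margins (equivalently, $\phi^{\leftarrow}$ is $d$-monotone on $(0,\infty)$). $\phi'$ denotes a non-decreasing version of the Radon-Nikodym derivative of $\phi$. $\bigwedge$ denotes minimum. *)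

theory Defs
  imports "HOL-Probability.Probability"
begin

(* Functions on [0,1] are total functions on the reals; values outside [0,1] are never used.
   In ennreal, 0 * top = 0, so the convexity inequality is harmless at t = 0 and t = 1 even
   where phi is infinite. "Decreasing" is read in the weak sense: strictness is forced as soon as
   the associated C is a copula. *)
definition archimedean_generator :: "(real \<Rightarrow> ennreal) \<Rightarrow> bool" where
  "archimedean_generator \<phi> \<longleftrightarrow>
     (\<forall>x\<in>{0..1}. \<forall>y\<in>{0..1}. \<forall>t\<in>{0..1}.
        \<phi> ((1 - t) * x + t * y) \<le> ennreal (1 - t) * \<phi> x + ennreal t * \<phi> y) \<and>
     antimono_on {0..1} \<phi> \<and>
     \<phi> 1 = 0"

definition generalized_inverse :: "(real \<Rightarrow> ennreal) \<Rightarrow> ennreal \<Rightarrow> real" where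
  "generalized_inverse \<phi> y = Inf {t \<in> {0..1}. \<phi> t \<le> y}"

(* Points of the d-dimensional cube are functions on the index set {1..d}. *)
definition archimedean_copula :: "nat \<Rightarrow> (real \<Rightarrow> ennreal) \<Rightarrow> (nat \<Rightarrow> real) \<Rightarrow> real" where
  "archimedean_copula d \<phi> u = generalized_inverse \<phi> (\<Sum>i\<in>{1..d}. \<phi> (u i))"

definition joint_cdf ::
  "'a measure \<Rightarrow> nat set \<Rightarrow> (nat \<Rightarrow> 'a \<Rightarrow> real) \<Rightarrow> (nat \<Rightarrow> real) \<Rightarrow> real" where
  "joint_cdf M I U u = measure M {\<omega> \<in> space M. \<forall>i\<in>I. U i \<omega> \<le> u i}"

definition is_copula :: "nat \<Rightarrow> ((nat \<Rightarrow> real) \<Rightarrow> real) \<Rightarrow> bool" where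
  "is_copula d C \<longleftrightarrow>
     (\<exists>\<mu>. prob_space \<mu> \<and> sets \<mu> = sets (Pi\<^sub>M {1..d} (\<lambda>_. borel :: real measure)) \<and>
        (\<forall>i\<in>{1..d}. distr \<mu> borel (\<lambda>x. x i) = uniform_measure lborel {0..1}) \<and>
        (\<forall>u \<in> {1..d} \<rightarrow>\<^sub>E {0..1}. joint_cdf \<mu> {1..d} (\<lambda>i x. x i) u = C u))"

(* A copula C is only given on the cube; since its margins are uniform on (0,1), its values there
   determine the whole distribution function. *)
definition has_distribution_function ::
  "'a measure \<Rightarrow> nat \<Rightarrow> (nat \<Rightarrow> 'a \<Rightarrow> real) \<Rightarrow> ((nat \<Rightarrow> real) \<Rightarrow> real) \<Rightarrow> bool" where
  "has_distribution_function M d U C \<longleftrightarrow>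
     (\<forall>i\<in>{1..d}. U i \<in> borel_measurable M) \<and>
     (\<forall>u \<in> {1..d} \<rightarrow>\<^sub>E {0..1}. joint_cdf M {1..d} U u = C u)"

(* phi' is a non-decreasing density, with respect to Lebesgue measure, of the set function
   (a,b] \<mapsto> phi(b) - phi(a) on (0,1]. The point 0 is excluded because phi may be infinite or
   have a jump there; on (0,1], phi is finite whenever the associated C is a copula, so enn2real
   loses nothing. *)
definition nondecreasing_RN_derivative :: "(real \<Rightarrow> ennreal) \<Rightarrow> (real \<Rightarrow> real) \<Rightarrow> bool" where
  "nondecreasing_RN_derivative \<phi> \<phi>' \<longleftrightarrow>
     mono_on {0<..<1} \<phi>' \<and>
     (\<forall>a b. 0 < a \<longrightarrow> a \<le> b \<longrightarrow> b \<le> 1 \<longrightarrow>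
        set_integrable lborel {a<..b} \<phi>' \<and>
        (LBINT t:{a<..b}. \<phi>' t) = enn2real (\<phi> b) - enn2real (\<phi> a))"

end

theory Submission
  imports Defs "HOL-Real_Asymp.Real_Asymp"
begin

text \<open>
  For small s the probability in question is the generalized inverse of \<open>\<phi>\<close> at
  \<open>\<Sum>i\<in>I. \<phi> (s * x i)\<close>, so it suffices to compare this sum with \<open>\<phi> (s * b)\<close> for b on either side
  of the limit; continuity of \<open>\<phi>\<close> is not needed. The comparison rests on regular variation:
  \<open>\<phi> (s * x) / \<phi> s\<close> tends to \<open>x powr (- \<theta>\<^sub>0)\<close>. Since \<open>\<phi>'\<close> is monotone, increments of \<open>\<phi>\<close> over
  \<open>{s<..t}\<close> lie between \<open>(t - s) * \<phi>' s\<close> and \<open>(t - s) * \<phi>' t\<close>. Hence, if \<open>- s * \<phi>' s / \<phi> s\<close> lies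
  between A and B near 0, iterating these bounds along the mesh \<open>s * x powr (k / n)\<close>, \<open>k \<le> n\<close>, and
  letting n tend to infinity squeezes \<open>\<phi> (s * x) / \<phi> s\<close> between \<open>x powr (- B)\<close> and \<open>x powr (- A)\<close>
  for \<open>x \<ge> 1\<close>. If \<open>\<theta>\<^sub>0 = \<infinity>\<close>, only the bound by arbitrarily large A is available, and it suffices.
\<close>

subsection \<open>Power bounds from bounds on the elasticity\<close>

text \<open>With L = \<open>ln x\<close> the mesh ratio is exp (L / n), so both bases are 1 plus or
  minus A * L / n up to O(1 / n^2). These are variants of Euler's limit for the exponential.\<close>

lemma geometric_mesh_limit:
  fixes x :: real
  assumes "1 \<le> x"
  shows "(\<lambda>n. (1 + A * (1 - 1 / x powr (1 / real n))) ^ n) \<longlonglongrightarrow> x powr A"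
    and "(\<lambda>n. (1 - A * (x powr (1 / real n) - 1)) ^ n) \<longlonglongrightarrow> x powr (- A)"
proof -
  have "(\<lambda>n. (1 + A * (1 - 1 / x powr (1 / real n))) ^ n) \<longlonglongrightarrow> x powr A
     \<and> (\<lambda>n. (1 - A * (x powr (1 / real n) - 1)) ^ n) \<longlonglongrightarrow> x powr (- A)"
  \<comment> \<open>In the degenerate case both bases are identically 1. Otherwise A * L is nonzero,
    which fixes the leading term of the expansions.\<close>
  proof (cases "A = 0 \<or> x = 1")
    case False
    define L where "L = ln x"
    have [simp]: "A * L \<noteq> 0"  "L > 0"
      using assms False by (auto simp: L_def)
    have x: "x powr y = exp (y * L)" for y
      using assms by (simp add: powr_def L_def)
    have "(\<lambda>n. (1 + A * (1 - 1 / exp (L / real n))) ^ n) \<longlonglongrightarrow> exp (A * L)"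
      by real_asymp
    moreover have "(\<lambda>n. (1 - A * (exp (L / real n) - 1)) ^ n) \<longlonglongrightarrow> exp (- (A * L))"
      by real_asymp
    ultimately show ?thesis by (simp add: x)
  qed (use assms in auto)
  then show "(\<lambda>n. (1 + A * (1 - 1 / x powr (1 / real n))) ^ n) \<longlonglongrightarrow> x powr A"
    and "(\<lambda>n. (1 - A * (x powr (1 / real n) - 1)) ^ n) \<longlonglongrightarrow> x powr (- A)"
    by auto
qed

lemma geometric_mesh_root_limit:
  fixes x :: real
  assumes "1 \<le> x"
  shows "(\<lambda>n. x powr (1 / real n)) \<longlonglongrightarrow> 1"
proof -
  have "(\<lambda>n. x powr (1 / real n)) \<longlonglongrightarrow> x powr 0"
    using assms by (intro tendsto_intros lim_1_over_n) auto
  then show ?thesis using assms by simp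
qed

lemma power_le_of_step:
  fixes u :: "nat \<Rightarrow> real"
  assumes "0 \<le> q" and "\<And>k. k < n \<Longrightarrow> q * u k \<le> u (Suc k)"
  shows "q ^ n * u 0 \<le> u n"
  using assms(2)
proof (induction n)
  case (Suc n)
  have "q ^ Suc n * u 0 = q * (q ^ n * u 0)" by simp
  also have "\<dots> \<le> q * u n"
    using Suc assms(1) by (intro mult_left_mono) auto
  also have "\<dots> \<le> u (Suc n)" using Suc by simp
  finally show ?case .
qed simp

text \<open>This replaces integrating -f' / f >= A / s, where \<open>g\<close> stands for -f'. No
  derivative of \<open>f\<close> is used, only a bound on increments by \<open>g\<close> at the
  right end, so the inequality is integrated by a discrete Gronwall argument on a geometric
  mesh.\<close>

lemma power_bound_if_elasticity_ge:
  fixes f g :: "real \<Rightarrow> real"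
  assumes diff: "\<And>s t. 0 < s \<Longrightarrow> s \<le> t \<Longrightarrow> t < \<delta> \<Longrightarrow> (t - s) * g t \<le> f s - f t"
    and elast: "\<And>s. 0 < s \<Longrightarrow> s < \<delta> \<Longrightarrow> A * f s \<le> s * g s"
    and "0 < a" "1 \<le> x" "a * x < \<delta>"
  shows "x powr A * f (a * x) \<le> f a"
proof -
  have step: "(1 + A * (1 - 1 / r)) * f (s * r) \<le> f s"
    if "0 < s" "1 \<le> r" "s * r < \<delta>" for s r
  proof -
    have "A * f (s * r) * (1 - 1 / r) \<le> s * r * g (s * r) * (1 - 1 / r)"
      using that by (intro mult_right_mono elast) auto
    also have "\<dots> = (s * r - s) * g (s * r)"
      using that by (simp add: field_simps)
    also have "\<dots> \<le> f s - f (s * r)"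
      using that by (intro diff) auto
    finally show ?thesis by (simp add: algebra_simps)
  qed
  have ev: "(1 + A * (1 - 1 / x powr (1 / real n))) ^ n * f (a * x) \<le> f a"
    if n: "n > 0" "0 \<le> 1 + A * (1 - 1 / x powr (1 / real n))" for n
  proof -
    define r where "r = x powr (1 / real n)"
    have r: "1 \<le> r" "r ^ n = x"
      using n assms by (auto simp: r_def ge_one_powr_ge_zero powr_realpow[symmetric] powr_powr)
    \<comment> \<open>A step bounds \<open>f\<close> at the left point by \<open>f\<close> at the
      right point, so the mesh is traversed downwards from a * x to a.\<close>
    have "(1 + A * (1 - 1 / r)) ^ n * f (a * r ^ (n - 0)) \<le> f (a * r ^ (n - n))"
    proof (rule power_le_of_step[where u = "\<lambda>k. f (a * r ^ (n - k))"])
      fix k assume "k < n"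
      then have eq: "r ^ (n - k) = r ^ (n - Suc k) * r"
        by (metis Suc_diff_Suc power_Suc2)
      have "r ^ (n - k) \<le> r ^ n" using r by (intro power_increasing) auto
      then have "a * r ^ (n - k) \<le> a * x" using r assms by simp
      then have "a * r ^ (n - k) < \<delta>" using assms by linarith
      then show "(1 + A * (1 - 1 / r)) * f (a * r ^ (n - k)) \<le> f (a * r ^ (n - Suc k))"
        using step[of "a * r ^ (n - Suc k)" r] r assms by (simp add: eq mult.assoc)
    qed (use n r_def in auto)
    then show ?thesis using r by (simp add: r_def)
  qed
  \<comment> \<open>\<open>A\<close> may be negative. The base is still positive for large n, as
    needed for multiplying the step inequalities.\<close>
  have "(\<lambda>n. 1 + A * (1 - 1 / x powr (1 / real n))) \<longlonglongrightarrow> 1 + A * (1 - 1 / 1)"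
    using assms by (intro tendsto_intros geometric_mesh_root_limit) auto
  then have "\<forall>\<^sub>F n in sequentially. 1 + A * (1 - 1 / x powr (1 / real n)) > 0"
    by (rule order_tendstoD) auto
  then have "\<forall>\<^sub>F n in sequentially. (1 + A * (1 - 1 / x powr (1 / real n))) ^ n * f (a * x) \<le> f a"
    using eventually_gt_at_top[of 0] by eventually_elim (auto intro: ev)
  moreover have "(\<lambda>n. (1 + A * (1 - 1 / x powr (1 / real n))) ^ n * f (a * x)) \<longlonglongrightarrow> x powr A * f (a * x)"
    using assms by (intro tendsto_intros geometric_mesh_limit)
  ultimately show ?thesis by (intro tendsto_upperbound) auto
qed

text \<open>Mirror image of the previous bound: \<open>g\<close> is now evaluated at the left end of
  each mesh interval, so the mesh is traversed upwards from a to a * x.\<close>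

lemma power_bound_if_elasticity_le:
  fixes f g :: "real \<Rightarrow> real"
  assumes diff: "\<And>s t. 0 < s \<Longrightarrow> s \<le> t \<Longrightarrow> t < \<delta> \<Longrightarrow> f s - f t \<le> (t - s) * g s"
    and elast: "\<And>s. 0 < s \<Longrightarrow> s < \<delta> \<Longrightarrow> s * g s \<le> B * f s"
    and "0 < a" "1 \<le> x" "a * x < \<delta>"
  shows "x powr (- B) * f a \<le> f (a * x)"
proof -
  have step: "(1 - B * (r - 1)) * f s \<le> f (s * r)"
    if "0 < s" "1 \<le> r" "s * r < \<delta>" for s r
  proof -
    have "s \<le> s * r" using that by simp
    then have "f s - f (s * r) \<le> (s * r - s) * g s"
      using that by (intro diff) auto
    also have "\<dots> = s * g s * (r - 1)"
      by (simp add: field_simps)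
    also have "\<dots> \<le> B * f s * (r - 1)"
      using that \<open>s \<le> s * r\<close> by (intro mult_right_mono elast) linarith+
    finally show ?thesis by (simp add: algebra_simps)
  qed
  have ev: "(1 - B * (x powr (1 / real n) - 1)) ^ n * f a \<le> f (a * x)"
    if n: "n > 0" "0 \<le> 1 - B * (x powr (1 / real n) - 1)" for n
  proof -
    define r where "r = x powr (1 / real n)"
    have r: "1 \<le> r" "r ^ n = x"
      using n assms by (auto simp: r_def ge_one_powr_ge_zero powr_realpow[symmetric] powr_powr)
    have "(1 - B * (r - 1)) ^ n * f (a * r ^ 0) \<le> f (a * r ^ n)"
    proof (rule power_le_of_step[where u = "\<lambda>k. f (a * r ^ k)"])
      fix k assume "k < n"
      then have "r ^ Suc k \<le> r ^ n" using r by (intro power_increasing) auto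
      then have "a * r ^ Suc k \<le> a * x" using r assms by simp
      then have "a * r ^ Suc k < \<delta>" using assms by linarith
      then show "(1 - B * (r - 1)) * f (a * r ^ k) \<le> f (a * r ^ Suc k)"
        using step[of "a * r ^ k" r] r assms by (simp add: mult_ac)
    qed (use n r_def in auto)
    then show ?thesis using r by (simp add: r_def)
  qed
  have "(\<lambda>n. 1 - B * (x powr (1 / real n) - 1)) \<longlonglongrightarrow> 1 - B * (1 - 1)"
    using assms by (intro tendsto_intros geometric_mesh_root_limit) auto
  then have "\<forall>\<^sub>F n in sequentially. 1 - B * (x powr (1 / real n) - 1) > 0"
    by (rule order_tendstoD) auto
  then have "\<forall>\<^sub>F n in sequentially. (1 - B * (x powr (1 / real n) - 1)) ^ n * f a \<le> f (a * x)"
    using eventually_gt_at_top[of 0] by eventually_elim (auto intro: ev)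
  moreover have "(\<lambda>n. (1 - B * (x powr (1 / real n) - 1)) ^ n * f a) \<longlonglongrightarrow> x powr (- B) * f a"
    using assms by (intro tendsto_intros geometric_mesh_limit)
  ultimately show ?thesis by (intro tendsto_upperbound) auto
qed

subsection \<open>Generalized inverses and margins of Archimedean copulas\<close>

lemma generalized_inverse_le:
  assumes "u \<in> {0..1}" "\<phi> u \<le> y"
  shows "generalized_inverse \<phi> y \<le> u"
  unfolding generalized_inverse_def
  using assms by (intro cInf_lower bdd_belowI[of _ 0]) auto

text \<open>The strict inequality matters: if y = \<phi> u and \<phi> is constant just to the left
  of u, the infimum lies below u.\<close>

lemma le_generalized_inverse:
  assumes "antimono_on {0..1} \<phi>" "\<phi> 1 = 0" "u \<in> {0..1}" "y < \<phi> u"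
  shows "u \<le> generalized_inverse \<phi> y"
  unfolding generalized_inverse_def
proof (rule cInf_greatest)
  show "{t \<in> {0..1}. \<phi> t \<le> y} \<noteq> {}"
    using assms(2) by (auto intro: exI[of _ 1])
  fix t assume "t \<in> {t \<in> {0..1}. \<phi> t \<le> y}"
  then show "u \<le> t"
    using assms monotone_onD[OF assms(1), of t u] by (force simp: not_le[symmetric])
qed

lemma generalized_inverse_nonneg:
  assumes "\<phi> 1 = 0"
  shows "0 \<le> generalized_inverse \<phi> y"
  unfolding generalized_inverse_def
  using assms by (intro cInf_greatest) (auto intro: exI[of _ 1])

text \<open>Comparing \<open>y s\<close> with \<phi> at the test points s * b brackets the infimum
  on either side of s * c. The slack between b and c makes this work without continuity of
  \<phi>.\<close>

lemma scaled_generalized_inverse_tendsto: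
  assumes anti: "antimono_on {0..1} \<phi>" and one: "\<phi> 1 = 0" and "0 \<le> c"
    and lower: "\<And>b. 0 < b \<Longrightarrow> b < c \<Longrightarrow> \<forall>\<^sub>F s in at_right 0. y s < \<phi> (s * b)"
    and upper: "\<And>b. c < b \<Longrightarrow> \<forall>\<^sub>F s in at_right 0. \<phi> (s * b) \<le> y s"
  shows "((\<lambda>s. inverse s * generalized_inverse \<phi> (y s)) \<longlongrightarrow> c) (at_right 0)"
proof -
  have small: "\<forall>\<^sub>F s in at_right 0. 0 < s \<and> s * b \<in> {0..1}" if "0 < b" for b :: real
    using that unfolding eventually_at_right_field
    by (intro exI[of _ "1 / b"]) (auto simp: field_simps)
  show ?thesis
  proof (rule order_tendstoI)
    fix b' assume "b' < c"
    then obtain b where b: "b' < b" "b < c" using dense by blast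
    show "\<forall>\<^sub>F s in at_right 0. b' < inverse s * generalized_inverse \<phi> (y s)"
    proof (cases "0 < b")
      case True
      show ?thesis using lower[OF True b(2)] small[OF True]
      proof eventually_elim
        case (elim s)
        then have "s * b \<le> generalized_inverse \<phi> (y s)"
          by (intro le_generalized_inverse anti one) auto
        then have "b \<le> inverse s * generalized_inverse \<phi> (y s)"
          using elim by (simp add: field_simps)
        then show ?case using b by simp
      qed
    next
      \<comment> \<open>For b <= 0 nonnegativity of the generalized inverse suffices; this is the
        only case when c = 0.\<close>
      case False
      show ?thesis using small[OF zero_less_one]
      proof eventually_elim
        case (elim s)
        then have "0 \<le> inverse s * generalized_inverse \<phi> (y s)"
          using generalized_inverse_nonneg[of \<phi>, OF one] by simp
        then show ?case using b False by linarith
      qed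
    qed
  next
    fix b' assume "c < b'"
    then obtain b where b: "c < b" "b < b'" using dense by blast
    then have "0 < b" using \<open>0 \<le> c\<close> by simp
    show "\<forall>\<^sub>F s in at_right 0. inverse s * generalized_inverse \<phi> (y s) < b'"
      using upper[OF b(1)] small[OF \<open>0 < b\<close>]
    proof eventually_elim
      case (elim s)
      then have "generalized_inverse \<phi> (y s) \<le> s * b"
        by (intro generalized_inverse_le) auto
      then have "inverse s * generalized_inverse \<phi> (y s) \<le> b"
        using elim by (simp add: field_simps)
      then show ?case using b by simp
    qed
  qed
qed

text \<open>A bound 1 on the coordinates outside \<open>I\<close> excludes only a null set.
  Restricting the vector to \<open>J\<close> makes it extensional, as the points of the cube
  are.\<close>

lemma joint_cdf_eq_if_AE_le_one:
  assumes "prob_space M" and "finite J" and meas: "\<And>i. i \<in> J \<Longrightarrow> U i \<in> borel_measurable M"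
    and le: "AE \<omega> in M. \<forall>i\<in>J. U i \<omega> \<le> 1" and "I \<subseteq> J"
  shows "joint_cdf M I U u = joint_cdf M J U (\<lambda>i\<in>J. if i \<in> I then u i else 1)"
proof -
  interpret prob_space M by fact
  have [measurable]: "U i \<in> borel_measurable M" if "i \<in> I" for i
    using meas \<open>I \<subseteq> J\<close> that by auto
  have [simp]: "countable I" "countable J"
    using assms by (auto intro: countable_finite finite_subset)
  note [measurable] = meas
  show ?thesis unfolding joint_cdf_def
  proof (rule finite_measure_eq_AE)
    show "AE \<omega> in M. (\<omega> \<in> {\<omega> \<in> space M. \<forall>i\<in>I. U i \<omega> \<le> u i}) =
       (\<omega> \<in> {\<omega> \<in> space M. \<forall>i\<in>J. U i \<omega> \<le> (\<lambda>i\<in>J. if i \<in> I then u i else 1) i})"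
      using le by eventually_elim (use \<open>I \<subseteq> J\<close> in auto)
  qed measurable
qed

lemma sum_generator_extended:
  fixes \<phi> :: "real \<Rightarrow> ennreal" and d :: nat
  assumes "\<phi> 1 = 0" "I \<subseteq> {1..d}"
  shows "(\<Sum>i\<in>{1..d}. \<phi> ((\<lambda>i\<in>{1..d}. if i \<in> I then u i else 1) i)) = (\<Sum>i\<in>I. \<phi> (u i))"
  by (rule sum.mono_neutral_cong_right) (use assms in auto)

text \<open>Evaluate the copula at (v, 1, ..., 1): uniformity of the first margin gives v, while
  \<phi> 1 = 0 leaves only the term \<phi> v in the formula. Finiteness and positivity of \<phi> on
  (0,1) will follow from this identity.\<close>

lemma copula_margin:
  assumes "d \<ge> 1" "\<phi> 1 = 0" "is_copula d (archimedean_copula d \<phi>)" "v \<in> {0..1}"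
  shows "generalized_inverse \<phi> (\<phi> v) = v"
proof -
  obtain \<mu> where "prob_space \<mu>"
    and [measurable_cong]: "sets \<mu> = sets (Pi\<^sub>M {1..d} (\<lambda>_. borel :: real measure))"
    and unif: "\<And>i. i \<in> {1..d} \<Longrightarrow> distr \<mu> borel (\<lambda>x. x i) = uniform_measure lborel {0..1}"
    and cdf: "\<And>u. u \<in> {1..d} \<rightarrow>\<^sub>E {0..1} \<Longrightarrow>
        joint_cdf \<mu> {1..d} (\<lambda>i x. x i) u = archimedean_copula d \<phi> u"
    using assms(3) unfolding is_copula_def by blast
  interpret \<mu>: prob_space \<mu> by fact
  have meas [measurable]: "(\<lambda>x. x i) \<in> borel_measurable \<mu>" if "i \<in> {1..d}" for i
    using that by measurable
  have dist: "measure \<mu> {x \<in> space \<mu>. x i \<le> w} = w" if "i \<in> {1..d}" "w \<in> {0..1}" for i w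
  proof -
    have "measure \<mu> {x \<in> space \<mu>. x i \<le> w} = measure (distr \<mu> borel (\<lambda>x. x i)) {..w}"
      using that by (subst measure_distr) (auto intro!: arg_cong[where f = "measure \<mu>"])
    also have "\<dots> = measure lborel ({0..1} \<inter> {..w})"
      using that by (simp add: unif)
    also have "{0..1} \<inter> {..w} = {0..w}" using that by auto
    finally show ?thesis using that by simp
  qed
  have "AE x in \<mu>. x i \<le> 1" if "i \<in> {1..d}" for i
    using dist[OF that, of 1] that by (intro \<mu>.AE_prob_1 [THEN eventually_mono]) auto
  then have AE: "AE x in \<mu>. \<forall>i\<in>{1..d}. x i \<le> 1"
    by (intro AE_finite_allI) auto
  let ?u = "\<lambda>i\<in>{1..d}. if i \<in> {1} then v else 1"
  have "v = joint_cdf \<mu> {1} (\<lambda>i x. x i) (\<lambda>_. v)"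
    using dist[of 1 v] assms by (simp add: joint_cdf_def)
  also have "\<dots> = joint_cdf \<mu> {1..d} (\<lambda>i x. x i) ?u"
    using AE assms meas by (intro joint_cdf_eq_if_AE_le_one \<mu>.prob_space_axioms) auto
  also have "\<dots> = archimedean_copula d \<phi> ?u"
    using assms by (intro cdf) auto
  also have "\<dots> = generalized_inverse \<phi> (\<Sum>i\<in>{1}. \<phi> v)"
    unfolding archimedean_copula_def using assms
    by (subst sum_generator_extended) auto
  finally show ?thesis by simp
qed

lemma joint_cdf_archimedean:
  assumes "d \<ge> 1" "\<phi> 1 = 0" "is_copula d (archimedean_copula d \<phi>)"
    and "prob_space M" and "has_distribution_function M d U (archimedean_copula d \<phi>)"
    and "I \<subseteq> {1..d}" "\<And>i. i \<in> I \<Longrightarrow> u i \<in> {0..1}"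
  shows "joint_cdf M I U u = generalized_inverse \<phi> (\<Sum>i\<in>I. \<phi> (u i))"
proof -
  interpret prob_space M by fact
  have meas [measurable]: "U i \<in> borel_measurable M" if "i \<in> {1..d}" for i
    using assms(5) that unfolding has_distribution_function_def by auto
  have cdf: "joint_cdf M {1..d} U w = archimedean_copula d \<phi> w"
    if "w \<in> {1..d} \<rightarrow>\<^sub>E {0..1}" for w
    using assms(5) that unfolding has_distribution_function_def by auto
  \<comment> \<open>The distribution function of \<open>U\<close> is prescribed on the cube only.
    Its value 1 at (1, ..., 1) shows that all coordinates are almost surely at most 1.\<close>
  have "joint_cdf M {1..d} U (\<lambda>i\<in>{1..d}. 1) = archimedean_copula d \<phi> (\<lambda>i\<in>{1..d}. 1)"
    by (intro cdf) auto
  also have "\<dots> = generalized_inverse \<phi> (\<phi> 1)"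
    using assms by (simp add: archimedean_copula_def)
  also have "\<dots> = 1"
    using assms by (intro copula_margin) auto
  finally have "measure M {\<omega> \<in> space M. \<forall>i\<in>{1..d}. U i \<omega> \<le> 1} = 1"
    by (simp add: joint_cdf_def)
  then have "AE \<omega> in M. \<omega> \<in> {\<omega> \<in> space M. \<forall>i\<in>{1..d}. U i \<omega> \<le> 1}"
    by (rule AE_prob_1)
  then have "AE \<omega> in M. \<forall>i\<in>{1..d}. U i \<omega> \<le> 1"
    by eventually_elim auto
  then have "joint_cdf M I U u = joint_cdf M {1..d} U (\<lambda>i\<in>{1..d}. if i \<in> I then u i else 1)"
    using assms meas by (intro joint_cdf_eq_if_AE_le_one) auto
  also have "\<dots> = archimedean_copula d \<phi> (\<lambda>i\<in>{1..d}. if i \<in> I then u i else 1)"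
    using assms by (intro cdf) auto
  also have "\<dots> = generalized_inverse \<phi> (\<Sum>i\<in>I. \<phi> (u i))"
    unfolding archimedean_copula_def using assms by (subst sum_generator_extended) auto
  finally show ?thesis .
qed

text \<open>If \<phi> v were infinite, 0 would compete in the infimum and force v = 0.\<close>

lemma generator_finite:
  assumes "\<And>v. v \<in> {0..1} \<Longrightarrow> generalized_inverse \<phi> (\<phi> v) = v" "0 < v" "v \<le> 1"
  shows "\<phi> v = ennreal (enn2real (\<phi> v))"
proof (cases "\<phi> v = \<top>")
  case True
  then have "generalized_inverse \<phi> (\<phi> v) \<le> 0"
    by (intro generalized_inverse_le) auto
  then show ?thesis using assms(1)[of v] assms by auto
qed (simp add: less_top)

text \<open>If \<phi> v were 0 = \<phi> 1, the generalized inverse at 0 would equal both v and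
  1.\<close>

lemma generator_pos:
  assumes "\<And>v. v \<in> {0..1} \<Longrightarrow> generalized_inverse \<phi> (\<phi> v) = v" "0 < v" "v < 1" "\<phi> 1 = 0"
  shows "0 < enn2real (\<phi> v)"
proof -
  have "\<phi> v \<noteq> 0"
    using assms(1)[of v] assms(1)[of 1] assms(2-4) by auto
  moreover have "\<phi> v = ennreal (enn2real (\<phi> v))"
    using assms(1-3) by (intro generator_finite) auto
  ultimately show ?thesis
    by (metis enn2real_nonneg ennreal_0 order_le_less)
qed

lemma RN_derivative_bounds:
  assumes "nondecreasing_RN_derivative \<phi> \<phi>'" "0 < s" "s \<le> t" "t < 1"
  shows "(t - s) * \<phi>' s \<le> enn2real (\<phi> t) - enn2real (\<phi> s)"
    and "enn2real (\<phi> t) - enn2real (\<phi> s) \<le> (t - s) * \<phi>' t"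
proof -
  have mono: "mono_on {0<..<1} \<phi>'"
    and int: "set_integrable lborel {s<..t} \<phi>'"
    and eq: "(LBINT r:{s<..t}. \<phi>' r) = enn2real (\<phi> t) - enn2real (\<phi> s)"
    using assms unfolding nondecreasing_RN_derivative_def by auto
  have const: "set_integrable lborel {s<..t} (\<lambda>_. c)" "(LBINT r:{s<..t}. c) = (t - s) * c" for c :: real
    using assms by (auto simp: set_integrable_def set_lebesgue_integral_def)
  have "(LBINT r:{s<..t}. \<phi>' s) \<le> (LBINT r:{s<..t}. \<phi>' r)"
    using assms by (intro set_integral_mono const int mono_onD[OF mono]) auto
  then show "(t - s) * \<phi>' s \<le> enn2real (\<phi> t) - enn2real (\<phi> s)"
    by (simp add: const eq)
  have "(LBINT r:{s<..t}. \<phi>' r) \<le> (LBINT r:{s<..t}. \<phi>' t)"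
    using assms by (intro set_integral_mono const int mono_onD[OF mono]) auto
  then show "enn2real (\<phi> t) - enn2real (\<phi> s) \<le> (t - s) * \<phi>' t"
    by (simp add: const eq)
qed

subsection \<open>Regular variation at zero\<close>

lemma eventually_small:
  fixes \<delta> b :: real
  assumes "0 < \<delta>" "0 < b"
  shows "\<forall>\<^sub>F s in at_right 0. 0 < s \<and> s * b < \<delta>"
  using assms unfolding eventually_at_right_field
  by (intro exI[of _ "\<delta> / b"]) (auto simp: field_simps)

lemma eventually_scale:
  fixes b :: real
  assumes "0 < b" "\<forall>\<^sub>F s in at_right 0. P s"
  shows "\<forall>\<^sub>F s in at_right 0. P (s * b)"
proof -
  obtain \<delta> where "0 < \<delta>" "\<And>s. 0 < s \<Longrightarrow> s < \<delta> \<Longrightarrow> P s"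
    using assms(2) unfolding eventually_at_right_field by auto
  then show ?thesis
    using eventually_small[OF \<open>0 < \<delta>\<close> assms(1)] assms(1) by (auto elim!: eventually_mono)
qed

text \<open>The analytic core, free of copulas and of \<open>ennreal\<close>: \<open>f\<close> will
  be \<phi> and \<open>g\<close> will be -\<phi>', so that the elasticity carries no sign. The two
  increment bounds record all that is used of \<open>g\<close> being a derivative.\<close>

locale elasticity_limit =
  fixes f g :: "real \<Rightarrow> real" and \<theta> :: ereal
  assumes pos: "\<And>s. 0 < s \<Longrightarrow> s < 1 \<Longrightarrow> 0 < f s"
    and antimono: "\<And>s t. 0 < s \<Longrightarrow> s \<le> t \<Longrightarrow> t < 1 \<Longrightarrow> f t \<le> f s"
    and diff_ge: "\<And>s t. 0 < s \<Longrightarrow> s \<le> t \<Longrightarrow> t < 1 \<Longrightarrow> (t - s) * g t \<le> f s - f t"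
    and diff_le: "\<And>s t. 0 < s \<Longrightarrow> s \<le> t \<Longrightarrow> t < 1 \<Longrightarrow> f s - f t \<le> (t - s) * g s"
    and elasticity: "((\<lambda>s. ereal (s * g s / f s)) \<longlongrightarrow> \<theta>) (at_right 0)"
begin

text \<open>Only a real number below \<theta> is required, so this half remains available for
  \<theta> = \<infinity>.\<close>

lemma eventually_power_bound_ge:
  assumes "ereal A < \<theta>" "1 \<le> x"
  shows "\<forall>\<^sub>F s in at_right 0. x powr A * f (s * x) \<le> f s"
proof -
  obtain \<delta> where "0 < \<delta>" and \<delta>: "\<And>s. 0 < s \<Longrightarrow> s < \<delta> \<Longrightarrow> A < s * g s / f s"
    using order_tendstoD(1)[OF elasticity assms(1)] unfolding eventually_at_right_field by auto
  show ?thesis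
    using eventually_small[of "min \<delta> 1" x]
  proof (rule eventually_mono)
    fix s assume s: "0 < s \<and> s * x < min \<delta> 1"
    show "x powr A * f (s * x) \<le> f s"
    proof (rule power_bound_if_elasticity_ge[where \<delta> = "min \<delta> 1" and g = g])
      fix t assume "0 < t" "t < min \<delta> 1"
      then show "A * f t \<le> t * g t"
        using \<delta>[of t] pos[of t] by (simp add: field_simps)
    qed (use s assms diff_ge in auto)
  qed (use \<open>0 < \<delta>\<close> assms in auto)
qed

lemma eventually_power_bound_le:
  assumes "\<theta> < ereal B" "1 \<le> x"
  shows "\<forall>\<^sub>F s in at_right 0. x powr (- B) * f s \<le> f (s * x)"
proof -
  obtain \<delta> where "0 < \<delta>" and \<delta>: "\<And>s. 0 < s \<Longrightarrow> s < \<delta> \<Longrightarrow> s * g s / f s < B"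
    using order_tendstoD(2)[OF elasticity assms(1)] unfolding eventually_at_right_field by auto
  show ?thesis
    using eventually_small[of "min \<delta> 1" x]
  proof (rule eventually_mono)
    fix s assume s: "0 < s \<and> s * x < min \<delta> 1"
    show "x powr (- B) * f s \<le> f (s * x)"
    proof (rule power_bound_if_elasticity_le[where \<delta> = "min \<delta> 1" and g = g])
      fix t assume "0 < t" "t < min \<delta> 1"
      then show "t * g t \<le> B * f t"
        using \<delta>[of t] pos[of t] by (simp add: field_simps)
    qed (use s assms diff_le in auto)
  qed (use \<open>0 < \<delta>\<close> assms in auto)
qed

lemma ratio_tendsto_ge_one:
  assumes "\<theta> = ereal r" "1 \<le> x"
  shows "((\<lambda>s. f (s * x) / f s) \<longlongrightarrow> x powr (- r)) (at_right 0)"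
proof -
  have cont: "((\<lambda>A. x powr (- A)) \<longlongrightarrow> x powr (- r)) F" if "((\<lambda>A. A) \<longlongrightarrow> r) F" for F
    using assms that by (intro tendsto_intros) auto
  show ?thesis
  proof (rule order_tendstoI)
    fix l assume "l < x powr (- r)"
    \<comment> \<open>By continuity of the power in its exponent, B can be taken slightly above r
      without losing the strict bound; A below r is found likewise for the upper estimate.\<close>
    then have "\<forall>\<^sub>F B in at_right r. l < x powr (- B) \<and> r < B"
      by (intro eventually_conj order_tendstoD(1)[OF cont] eventually_at_right_less) auto
    then obtain B where B: "l < x powr (- B)" "r < B"
      by (auto dest: eventually_happens)
    have le: "\<forall>\<^sub>F s in at_right 0. x powr (- B) * f s \<le> f (s * x)"
      using assms B by (intro eventually_power_bound_le) auto
    show "\<forall>\<^sub>F s in at_right 0. l < f (s * x) / f s"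
      using le eventually_small[of 1 1, simplified]
    proof eventually_elim
      case (elim s)
      then have "x powr (- B) \<le> f (s * x) / f s"
        using pos[of s] by (simp add: field_simps)
      then show ?case using B by simp
    qed
  next
    fix l assume "x powr (- r) < l"
    then have "\<forall>\<^sub>F A in at_left r. x powr (- A) < l"
      by (intro order_tendstoD(2)[OF cont]) auto
    moreover have "\<forall>\<^sub>F A in at_left r. A < r"
      by (simp add: eventually_at_filter)
    ultimately have "\<forall>\<^sub>F A in at_left r. x powr (- A) < l \<and> A < r"
      by (rule eventually_conj)
    then obtain A where A: "x powr (- A) < l" "A < r"
      by (auto dest: eventually_happens)
    have ge: "\<forall>\<^sub>F s in at_right 0. x powr A * f (s * x) \<le> f s"
      using assms A by (intro eventually_power_bound_ge) auto
    show "\<forall>\<^sub>F s in at_right 0. f (s * x) / f s < l"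
      using ge eventually_small[of 1 1, simplified]
    proof eventually_elim
      case (elim s)
      then have "f (s * x) / f s \<le> x powr (- A)"
        using pos[of s] assms by (simp add: field_simps powr_minus)
      then show ?case using A by simp
    qed
  qed
qed

text \<open>For x < 1, apply the case 1 / x >= 1 at the point s * x and take reciprocals.\<close>

lemma ratio_tendsto:
  assumes "\<theta> = ereal r" "0 < x"
  shows "((\<lambda>s. f (s * x) / f s) \<longlongrightarrow> x powr (- r)) (at_right 0)"
proof (cases "1 \<le> x")
  case False
  have "((\<lambda>s. f (s * x * (1 / x)) / f (s * x)) \<longlongrightarrow> (1 / x) powr (- r)) (at_right 0)"
    unfolding tendsto_def
  proof (intro allI impI)
    fix S :: "real set" assume S: "open S" "(1 / x) powr (- r) \<in> S"
    have "((\<lambda>s. f (s * (1 / x)) / f s) \<longlongrightarrow> (1 / x) powr (- r)) (at_right 0)"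
      using False assms by (intro ratio_tendsto_ge_one) auto
    then have "\<forall>\<^sub>F s in at_right 0. f (s * (1 / x)) / f s \<in> S"
      using S by (rule topological_tendstoD)
    then show "\<forall>\<^sub>F s in at_right 0. f (s * x * (1 / x)) / f (s * x) \<in> S"
      by (rule eventually_scale[OF assms(2)])
  qed
  then have "((\<lambda>s. inverse (f s / f (s * x))) \<longlongrightarrow> inverse ((1 / x) powr (- r))) (at_right 0)"
    using assms by (intro tendsto_inverse) auto
  then show ?thesis
    using assms by (simp add: powr_divide powr_minus)
qed (use assms ratio_tendsto_ge_one in auto)

section \<open>Comparison of a sum of values of \<open>f\<close> with a single value\<close>

lemma sum_ratio_tendsto:
  assumes "\<theta> = ereal r" "\<And>i. i \<in> I \<Longrightarrow> 0 < x i"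
  shows "((\<lambda>s. (\<Sum>i\<in>I. f (s * x i)) / f s) \<longlongrightarrow> (\<Sum>i\<in>I. x i powr (- r))) (at_right 0)"
  unfolding sum_divide_distrib using assms by (intro tendsto_sum ratio_tendsto) auto

text \<open>After division by \<open>f s\<close> both sides converge, and the strict order of the
  limits carries over to small s.\<close>

lemma eventually_sum_less:
  assumes "\<theta> = ereal r" "\<And>i. i \<in> I \<Longrightarrow> 0 < x i" "0 < b" "(\<Sum>i\<in>I. x i powr (- r)) < b powr (- r)"
  shows "\<forall>\<^sub>F s in at_right 0. (\<Sum>i\<in>I. f (s * x i)) < f (s * b)"
proof -
  have "((\<lambda>s. f (s * b) / f s - (\<Sum>i\<in>I. f (s * x i)) / f s)
      \<longlongrightarrow> b powr (- r) - (\<Sum>i\<in>I. x i powr (- r))) (at_right 0)"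
    using assms by (intro tendsto_diff ratio_tendsto sum_ratio_tendsto)
  then have "\<forall>\<^sub>F s in at_right 0. 0 < f (s * b) / f s - (\<Sum>i\<in>I. f (s * x i)) / f s"
    by (rule order_tendstoD) (use assms in auto)
  then show ?thesis
    using eventually_small[of 1 1, simplified]
    by eventually_elim (use pos in \<open>auto simp: divide_less_cancel dest: less_asym\<close>)
qed

lemma eventually_less_sum:
  assumes "\<theta> = ereal r" "\<And>i. i \<in> I \<Longrightarrow> 0 < x i" "0 < b" "b powr (- r) < (\<Sum>i\<in>I. x i powr (- r))"
  shows "\<forall>\<^sub>F s in at_right 0. f (s * b) < (\<Sum>i\<in>I. f (s * x i))"
proof -
  have "((\<lambda>s. (\<Sum>i\<in>I. f (s * x i)) / f s - f (s * b) / f s)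
      \<longlongrightarrow> (\<Sum>i\<in>I. x i powr (- r)) - b powr (- r)) (at_right 0)"
    using assms by (intro tendsto_diff ratio_tendsto sum_ratio_tendsto)
  then have "\<forall>\<^sub>F s in at_right 0. 0 < (\<Sum>i\<in>I. f (s * x i)) / f s - f (s * b) / f s"
    by (rule order_tendstoD) (use assms in auto)
  then show ?thesis
    using eventually_small[of 1 1, simplified]
    by eventually_elim (use pos in \<open>auto simp: divide_less_cancel dest: less_asym\<close>)
qed

text \<open>With c the minimum, the sum is at most |I| times \<open>f (s * c)\<close>, whereas
  \<open>f (s * b)\<close> is at least (c / b)^A times it. Since c / b > 1 and every A is allowed,
  the latter factor can be made larger than |I|.\<close>

lemma eventually_sum_less_Min:
  assumes "\<theta> = \<infinity>" "finite I" "I \<noteq> {}" "0 < b" "b < Min (x ` I)"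
  shows "\<forall>\<^sub>F s in at_right 0. (\<Sum>i\<in>I. f (s * x i)) < f (s * b)"
proof -
  define c where "c = Min (x ` I)"
  have c: "b < c" "0 < c" "\<And>i. i \<in> I \<Longrightarrow> c \<le> x i"
    using assms by (auto simp: c_def)
  have "\<forall>\<^sub>F A in at_top. real (card I) < (c / b) powr A"
    using c assms by real_asymp
  then obtain A where A: "real (card I) < (c / b) powr A"
    by (auto dest: eventually_happens)
  have "\<forall>\<^sub>F s in at_right 0. (c / b) powr A * f (s * b * (c / b)) \<le> f (s * b)"
    using c assms by (intro eventually_scale[OF \<open>0 < b\<close>] eventually_power_bound_ge) auto
  moreover have "\<forall>\<^sub>F s in at_right 0. \<forall>i\<in>I. 0 < s \<and> s * x i < 1"
    using c assms by (intro eventually_ball_finite ballI eventually_small) force+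
  moreover have "\<forall>\<^sub>F s in at_right 0. 0 < s \<and> s * c < 1"
    using c by (intro eventually_small) auto
  ultimately show ?thesis
  proof eventually_elim
    case (elim s)
    have "(\<Sum>i\<in>I. f (s * x i)) \<le> (\<Sum>i\<in>I. f (s * c))"
      using elim c by (intro sum_mono antimono) auto
    also have "\<dots> = real (card I) * f (s * c)" by simp
    also have "\<dots> < (c / b) powr A * f (s * c)"
      using A pos[of "s * c"] elim c by (intro mult_strict_right_mono) auto
    also have "\<dots> \<le> f (s * b)" using elim assms by simp
    finally show ?case .
  qed
qed

text \<open>A single term with \<open>x j < b\<close> already dominates, by monotonicity and
  positivity of \<open>f\<close>.\<close>

lemma eventually_le_sum_Min:
  assumes "finite I" "I \<noteq> {}" "\<And>i. i \<in> I \<Longrightarrow> 0 < x i" "Min (x ` I) < b"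
  shows "\<forall>\<^sub>F s in at_right 0. f (s * b) \<le> (\<Sum>i\<in>I. f (s * x i))"
proof -
  have "Min (x ` I) \<in> x ` I" using assms by (intro Min_in) auto
  then obtain j where j: "j \<in> I" "x j < b" using assms by force
  then have "0 < b" using assms(3)[of j] by simp
  have "\<forall>\<^sub>F s in at_right 0. \<forall>i\<in>I. 0 < s \<and> s * x i < 1"
    using assms by (intro eventually_ball_finite ballI eventually_small) auto
  then show ?thesis
    using eventually_small[OF zero_less_one \<open>0 < b\<close>]
  proof eventually_elim
    case (elim s)
    have "f (s * b) \<le> f (s * x j)"
      using elim j assms(3)[of j] by (intro antimono) auto
    also have "\<dots> \<le> (\<Sum>i\<in>I. f (s * x i))"
      using elim j assms by (intro member_le_sum less_imp_le[OF pos]) auto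
    finally show ?case .
  qed
qed

end

section \<open>From regular variation of the generator to the lower tail of the copula\<close>

theorem theorem3p1:
  fixes d :: nat and \<phi> :: "real \<Rightarrow> ennreal" and \<phi>' :: "real \<Rightarrow> real"
    and M :: "'a measure" and U :: "nat \<Rightarrow> 'a \<Rightarrow> real" and \<theta>\<^sub>0 :: ereal
    and I :: "nat set" and x :: "nat \<Rightarrow> real"
  assumes "d \<ge> 2"
    and "archimedean_generator \<phi>"
    and "is_copula d (archimedean_copula d \<phi>)"
    and "nondecreasing_RN_derivative \<phi> \<phi>'"
    and "prob_space M"
    and "has_distribution_function M d U (archimedean_copula d \<phi>)"
    and "0 \<le> \<theta>\<^sub>0"
    and "((\<lambda>s. ereal (- (s * \<phi>' s / enn2real (\<phi> s)))) \<longlongrightarrow> \<theta>\<^sub>0) (at_right 0)"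
    and "I \<subseteq> {1..d}" and "card I \<ge> 2"
    and "\<forall>i\<in>I. x i > 0"
  shows "((\<lambda>s. inverse s * measure M {\<omega> \<in> space M. \<forall>i\<in>I. U i \<omega> \<le> s * x i}) \<longlongrightarrow>
           (if \<theta>\<^sub>0 = 0 then 0
            else if \<theta>\<^sub>0 = \<infinity> then Min (x ` I)
            else (\<Sum>i\<in>I. x i powr (- real_of_ereal \<theta>\<^sub>0)) powr (- 1 / real_of_ereal \<theta>\<^sub>0)))
         (at_right 0)"
proof -
  interpret prob_space M by fact
  define f where "f s = enn2real (\<phi> s)" for s
  define c where "c = (if \<theta>\<^sub>0 = 0 then 0
    else if \<theta>\<^sub>0 = \<infinity> then Min (x ` I)
    else (\<Sum>i\<in>I. x i powr (- real_of_ereal \<theta>\<^sub>0)) powr (- 1 / real_of_ereal \<theta>\<^sub>0))"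
  have anti: "antimono_on {0..1} \<phi>" and one: "\<phi> 1 = 0"
    using assms(2) unfolding archimedean_generator_def by auto
  have inv: "generalized_inverse \<phi> (\<phi> v) = v" if "v \<in> {0..1}" for v
    using copula_margin[of d \<phi>] assms one that by simp
  have fin: "\<phi> v = ennreal (f v)" if "0 < v" "v \<le> 1" for v
    unfolding f_def using inv that by (rule generator_finite)
  have nonneg: "0 \<le> f v" for v by (simp add: f_def)
  have x: "0 < x i" if "i \<in> I" for i using assms that by auto
  have powr_pos: "0 < x i powr y" if "i \<in> I" for i y using x[OF that] by simp
  have I: "finite I" "I \<noteq> {}" using assms by (auto intro: finite_subset)
  interpret elasticity_limit f "\<lambda>s. - \<phi>' s" \<theta>\<^sub>0
  proof
    show "0 < f s" if "0 < s" "s < 1" for s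
      unfolding f_def using inv that one by (rule generator_pos)
    show "f t \<le> f s" if "0 < s" "s \<le> t" "t < 1" for s t
      using monotone_onD[OF anti, of s t] fin[of s] that
      unfolding f_def by (intro enn2real_mono) (auto simp: less_top[symmetric])
    show "(t - s) * - \<phi>' t \<le> f s - f t" "f s - f t \<le> (t - s) * - \<phi>' s"
      if "0 < s" "s \<le> t" "t < 1" for s t
      using RN_derivative_bounds[OF assms(4) that] unfolding f_def by auto
    show "((\<lambda>s. ereal (s * - \<phi>' s / f s)) \<longlongrightarrow> \<theta>\<^sub>0) (at_right 0)"
      using assms(8) unfolding f_def by simp
  qed
  \<comment> \<open>For such s all arguments lie in (0,1), where \<phi> is finite, so sums in
    \<open>ennreal\<close> can be compared as real sums.\<close>
  have small: "\<forall>\<^sub>F s in at_right 0. \<forall>i\<in>I. 0 < s \<and> s * x i < 1"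
    using I x by (intro eventually_ball_finite ballI eventually_small) auto
  have sum_\<phi>: "(\<Sum>i\<in>I. \<phi> (s * x i)) = ennreal (\<Sum>i\<in>I. f (s * x i))"
    if "\<forall>i\<in>I. 0 < s \<and> s * x i < 1" for s
  proof -
    have "(\<Sum>i\<in>I. \<phi> (s * x i)) = (\<Sum>i\<in>I. ennreal (f (s * x i)))"
      using that x by (intro sum.cong fin) auto
    then show ?thesis by (simp add: nonneg)
  qed
  have "0 \<le> c"
    unfolding c_def using I x by (auto intro: less_imp_le)
  have lower: "\<forall>\<^sub>F s in at_right 0. (\<Sum>i\<in>I. f (s * x i)) < f (s * b)" if b: "0 < b" "b < c" for b
  proof (cases "\<theta>\<^sub>0 = \<infinity>")
    case True
    then show ?thesis using b I by (intro eventually_sum_less_Min) (auto simp: c_def)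
  next
    case False
    then obtain r where r: "\<theta>\<^sub>0 = ereal r" using assms(7) by (cases \<theta>\<^sub>0) auto
    \<comment> \<open>If r = 0 then c = 0 and no b satisfies 0 < b < c.\<close>
    have "r > 0" using r b assms(7) by (auto simp: c_def zero_ereal_def split: if_splits)
    define S where "S = (\<Sum>i\<in>I. x i powr (- r))"
    have "S > 0" unfolding S_def using I x by (intro sum_pos powr_pos) auto
    have "b < S powr (- 1 / r)"
      using b r \<open>r > 0\<close> by (auto simp: c_def S_def zero_ereal_def)
    \<comment> \<open>Raising to the power -r reverses the order and turns the claimed limit back
      into the sum \<open>S\<close>.\<close>
    then have "(S powr (- 1 / r)) powr (- r) < b powr (- r)"
      using b \<open>r > 0\<close> by (intro powr_less_mono2_neg) auto
    then have "S < b powr (- r)" using \<open>r > 0\<close> \<open>S > 0\<close> by (simp add: powr_powr)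
    then show ?thesis
      using r x b unfolding S_def by (intro eventually_sum_less) auto
  qed
  have upper: "\<forall>\<^sub>F s in at_right 0. f (s * b) \<le> (\<Sum>i\<in>I. f (s * x i))" if b: "c < b" for b
  proof (cases "\<theta>\<^sub>0 = \<infinity>")
    case True
    then show ?thesis using b I x by (intro eventually_le_sum_Min) (auto simp: c_def)
  next
    case False
    then obtain r where r: "\<theta>\<^sub>0 = ereal r" using assms(7) by (cases \<theta>\<^sub>0) auto
    have "b > 0" using b \<open>0 \<le> c\<close> by simp
    define S where "S = (\<Sum>i\<in>I. x i powr (- r))"
    have "S > 0" unfolding S_def using I x by (intro sum_pos powr_pos) auto
    have "b powr (- r) < S"
    \<comment> \<open>For r = 0 all powers equal 1, so the claim reads 1 < |I|. Here two indices
      matter: a single one would give equality.\<close>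
    proof (cases "r = 0")
      case True
      have "S = real (card I)" unfolding S_def True using x by (simp add: less_imp_neq[symmetric])
      then show ?thesis using True assms(10) \<open>b > 0\<close> by simp
    next
      case False
      then have "r > 0" using r assms(7) by (auto simp: zero_ereal_def)
      have "S powr (- 1 / r) < b"
        using b r \<open>r > 0\<close> by (auto simp: c_def S_def zero_ereal_def)
      then have "b powr (- r) < (S powr (- 1 / r)) powr (- r)"
        using \<open>S > 0\<close> \<open>r > 0\<close> by (intro powr_less_mono2_neg) auto
      then show ?thesis using \<open>r > 0\<close> \<open>S > 0\<close> by (simp add: powr_powr)
    qed
    then have "\<forall>\<^sub>F s in at_right 0. f (s * b) < (\<Sum>i\<in>I. f (s * x i))"
      using r x \<open>b > 0\<close> unfolding S_def by (intro eventually_less_sum) auto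
    then show ?thesis by eventually_elim simp
  qed
  have "((\<lambda>s. inverse s * generalized_inverse \<phi> (\<Sum>i\<in>I. \<phi> (s * x i))) \<longlongrightarrow> c) (at_right 0)"
  proof (rule scaled_generalized_inverse_tendsto[OF anti one \<open>0 \<le> c\<close>])
    fix b assume b: "0 < b" "b < c"
    show "\<forall>\<^sub>F s in at_right 0. (\<Sum>i\<in>I. \<phi> (s * x i)) < \<phi> (s * b)"
      using lower[OF b] small eventually_small[OF zero_less_one b(1)]
      by eventually_elim (use b in \<open>simp add: sum_\<phi> fin ennreal_less_iff sum_nonneg nonneg\<close>)
  next
    fix b assume b: "c < b"
    then have "0 < b" using \<open>0 \<le> c\<close> by simp
    show "\<forall>\<^sub>F s in at_right 0. \<phi> (s * b) \<le> (\<Sum>i\<in>I. \<phi> (s * x i))"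
      using upper[OF b] small eventually_small[OF zero_less_one \<open>0 < b\<close>]
      by eventually_elim (use \<open>0 < b\<close> in \<open>simp add: sum_\<phi> fin ennreal_leI\<close>)
  qed
  \<comment> \<open>The formula for the joint distribution function needs all s * x i in [0,1], so
    it holds for small s only.\<close>
  moreover have "\<forall>\<^sub>F s in at_right 0. inverse s * generalized_inverse \<phi> (\<Sum>i\<in>I. \<phi> (s * x i))
      = inverse s * measure M {\<omega> \<in> space M. \<forall>i\<in>I. U i \<omega> \<le> s * x i}"
    using small
  proof eventually_elim
    case (elim s)
    have "joint_cdf M I U (\<lambda>i. s * x i) = generalized_inverse \<phi> (\<Sum>i\<in>I. \<phi> (s * x i))"
      using assms one elim x by (intro joint_cdf_archimedean) (auto intro: less_imp_le)
    then show ?case by (simp add: joint_cdf_def)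
  qed
  ultimately show ?thesis
    unfolding c_def[symmetric] by (rule Lim_transform_eventually)
qed

end
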